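(* Let $k$ be a positive integer that is not a perfect square, let $d$ be a positive rational number, and let $f(x)=\dfrac{dx+k}{x+d}$, acting on $\mathbb{R}\cup\{\infty\}$. The following are equivalent: (a) $R=\dfrac{4d^2}{k-d^2}$ is an integer; (b) some iterate $f^n(\infty)$ with $n\ge 1$ is a Pellian convergent of $\sqrt{k}$, i.e. equals $p/q$ with $p,q$ positive integers satisfying $p^2-kq^2=\pm1$; (c) infinitely many of the iterates $f^n(\infty)$, $n\ge1$, are continued fraction convergents of $\sqrt{k}$.
   Context: $f^n$ denotes the $n$-fold composite of $f$, and $f(\infty)=d$. If $\sqrt{k}=[c_0;c_1,c_2,\dots]$ is the simple continued fraction expansion of $\sqrt k$, its convergents are the rationals $[c_0;c_1,\dots,c_j]$, $j\ge0$. *)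

theory Defs
  imports Complex_Main
begin

text \<open>The real projective line, the real numbers with a single point at infinity.\<close>

datatype real_line = Fin real | Infty

text \<open>The action of the map \<open>x \<mapsto> (d x + k) / (x + d)\<close> on the projective line. Sending the zero
  \<open>- d\<close> of the denominator to infinity is the usual convention when \<open>d\<^sup>2 \<noteq> k\<close>, so that
  the numerator does not vanish there.\<close>

fun moebius :: "real \<Rightarrow> real \<Rightarrow> real_line \<Rightarrow> real_line" where
  "moebius d k Infty = Fin d"
| "moebius d k (Fin x) = (if x + d = 0 then Infty else Fin ((d * x + k) / (x + d)))"

text \<open>Complete quotients and partial quotients of the simple continued fraction of an irrational
  number. For rational numbers, where the expansion terminates, these sequences have no
  meaning from the termination point on.\<close>

primrec complete_quotient :: "real \<Rightarrow> nat \<Rightarrow> real" where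
  "complete_quotient x 0 = x"
| "complete_quotient x (Suc n) =
     1 / (complete_quotient x n - of_int \<lfloor>complete_quotient x n\<rfloor>)"

definition partial_quotient :: "real \<Rightarrow> nat \<Rightarrow> int" where
  "partial_quotient x n = \<lfloor>complete_quotient x n\<rfloor>"

text \<open>The value of the finite continued fraction \<open>[c\<^sub>0; c\<^sub>1, \<dots>, c\<^sub>j]\<close>; the value at the empty list
  is a dummy.\<close>

fun cfrac_value :: "int list \<Rightarrow> real" where
  "cfrac_value [] = 0"
| "cfrac_value [c] = of_int c"
| "cfrac_value (c # c' # cs) = of_int c + 1 / cfrac_value (c' # cs)"

definition convergent_of :: "real \<Rightarrow> nat \<Rightarrow> real" where
  "convergent_of x j = cfrac_value (map (partial_quotient x) [0..<Suc j])"

definition is_cfrac_convergent :: "real \<Rightarrow> real_line \<Rightarrow> bool" where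
  "is_cfrac_convergent x y \<longleftrightarrow> (\<exists>j. y = Fin (convergent_of x j))"

definition is_pellian_convergent :: "nat \<Rightarrow> real_line \<Rightarrow> bool" where
  "is_pellian_convergent k y \<longleftrightarrow>
     (\<exists>p q :: nat. p > 0 \<and> q > 0 \<and> y = Fin (real p / real q) \<and>
        ((int p)\<^sup>2 - int k * (int q)\<^sup>2 = 1 \<or> (int p)\<^sup>2 - int k * (int q)\<^sup>2 = - 1))"

end

theory Submission
  imports Defs
begin

text \<open>Put \<open>u = (d + \<surd>k) / (d - \<surd>k)\<close>. The map \<open>x \<mapsto> (x + \<surd>k) / (x - \<surd>k)\<close> conjugates \<open>f\<close> to
  multiplication by \<open>u\<close> and sends \<open>\<infinity>\<close> to \<open>1\<close>, so \<open>f\<^sup>n(\<infinity>) = p/q\<close> means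
  \<open>u\<^sup>n = (p + q\<surd>k) / (p - q\<surd>k)\<close>. The number \<open>u\<close> has norm \<open>1\<close> and trace \<open>-2 - R\<close>.

  If \<open>R\<close> is an integer, the powers of \<open>u\<close> are governed by a Lucas sequence over the integers;
  it is periodic modulo every \<open>M\<close>, so some \<open>u\<^sup>m = p + q\<surd>k\<close> has integral \<open>p, q\<close>, and
  \<open>f\<^sup>2\<^sup>m(\<infinity>) = p/q\<close>. If \<open>f\<^sup>n(\<infinity>)\<close> is Pellian, so are all \<open>f\<^sup>n\<^sup>m(\<infinity>)\<close>, and these are convergents by
  Legendre's criterion. Finally, a convergent \<open>p/q\<close> has bounded norm \<open>p\<^sup>2 - k q\<^sup>2\<close>, so under (c)
  the traces of \<open>u\<^sup>n\<close> have bounded denominators for infinitely many \<open>n\<close>; but if the trace of \<open>u\<close>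
  has denominator \<open>y\<close>, then that of \<open>u\<^sup>n\<close> has denominator \<open>y\<^sup>n\<close>, whence \<open>y = 1\<close>.\<close>

section \<open>Continued fractions\<close>

lemma complete_quotient_Suc_shift:
  "complete_quotient x (Suc n) = complete_quotient (1 / (x - of_int \<lfloor>x\<rfloor>)) n"
  by (induction n) simp_all

lemma convergent_of_0: "convergent_of x 0 = of_int \<lfloor>x\<rfloor>"
  by (simp add: convergent_of_def partial_quotient_def)

text \<open>Splitting off the first partial quotient, rather than the last, lets later inductions
  pass from \<open>x\<close> to its complete quotient.\<close>

lemma convergent_of_Suc:
  "convergent_of x (Suc n) = of_int \<lfloor>x\<rfloor> + 1 / convergent_of (1 / (x - of_int \<lfloor>x\<rfloor>)) n"
proof -
  let ?y = "1 / (x - of_int \<lfloor>x\<rfloor>)"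
  have upt: "[0..<Suc (Suc n)] = 0 # map Suc [0..<Suc n]"
    by (metis map_Suc_upt upt_conv_Cons zero_less_Suc)
  have "partial_quotient x (Suc i) = partial_quotient ?y i" for i
    unfolding partial_quotient_def complete_quotient_Suc_shift ..
  then have "map (partial_quotient x) [0..<Suc (Suc n)]
      = \<lfloor>x\<rfloor> # map (partial_quotient ?y) [0..<Suc n]"
    unfolding upt by (simp add: partial_quotient_def)
  moreover obtain c cs where "map (partial_quotient ?y) [0..<Suc n] = c # cs"
    by (cases "map (partial_quotient ?y) [0..<Suc n]") auto
  ultimately show ?thesis
    unfolding convergent_of_def by (metis cfrac_value.simps(3))
qed

lemma irrational_shift:
  fixes x :: real
  assumes "x \<notin> \<rat>"
  shows "x - of_int \<lfloor>x\<rfloor> > 0" "1 / (x - of_int \<lfloor>x\<rfloor>) > 1" "1 / (x - of_int \<lfloor>x\<rfloor>) \<notin> \<rat>"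
proof -
  let ?z = "x - of_int \<lfloor>x\<rfloor>"
  have "x \<noteq> of_int \<lfloor>x\<rfloor>" using assms by (metis Rats_of_int)
  then show pos: "?z > 0" using of_int_floor_le[of x] by linarith
  have "?z < 1" by linarith
  then show "1 / ?z > 1" using pos by (simp add: field_simps)
  show "1 / ?z \<notin> \<rat>"
  proof
    assume "1 / ?z \<in> \<rat>"
    then have "inverse (1 / ?z) + of_int \<lfloor>x\<rfloor> \<in> \<rat>" by (intro Rats_add Rats_inverse) simp_all
    then show False using assms pos by simp
  qed
qed

text \<open>The matrix with rows \<open>p r\<close> and \<open>q s\<close> is the product of the
  matrices with rows \<open>c 1\<close> and \<open>1 0\<close>, where \<open>c\<close> runs over the
  partial quotients up to index \<open>n\<close>; each factor has determinant -1. As a Moebius map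
  it sends the next complete quotient to \<open>x\<close>. The sign conditions come from
  \<open>x > 1\<close>, which makes all partial quotients at least 1.\<close>

lemma convergent_of_matrix:
  fixes x :: real
  assumes "x \<notin> \<rat>" "x > 1"
  shows "\<exists>p q r s :: int. p \<ge> 1 \<and> q \<ge> 1 \<and> r \<ge> 0 \<and> s \<ge> 0 \<and> \<bar>p * s - q * r\<bar> = 1 \<and>
           complete_quotient x (Suc n) > 1 \<and>
           x * (of_int q * complete_quotient x (Suc n) + of_int s)
             = of_int p * complete_quotient x (Suc n) + of_int r \<and>
           convergent_of x n = of_int p / of_int q"
  using assms
proof (induction n arbitrary: x)
  case 0
  define z where "z = 1 / (x - of_int \<lfloor>x\<rfloor>)"
  have z: "complete_quotient x (Suc 0) = z" by (simp add: z_def)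
  have "z > 1" "x * z = of_int \<lfloor>x\<rfloor> * z + 1"
    using irrational_shift[OF 0(1)] by (auto simp: z_def field_simps)
  moreover have "\<lfloor>x\<rfloor> \<ge> 1" using 0(2) by linarith
  \<comment> \<open>The second column \<open>1, 0\<close> stands for the formal convergent 1/0 of
    index -1.\<close>
  ultimately show ?case
    unfolding z
    by (intro exI[of _ "\<lfloor>x\<rfloor>"] exI[of _ 1] exI[of _ 1] exI[of _ 0]) (auto simp: convergent_of_0)
next
  case (Suc n)
  define y where "y = 1 / (x - of_int \<lfloor>x\<rfloor>)"
  have y: "y \<notin> \<rat>" "y > 1" and xy: "x = of_int \<lfloor>x\<rfloor> + 1 / y"
    using irrational_shift[OF Suc.prems(1)] by (auto simp: y_def)
  define z where "z = complete_quotient y (Suc n)"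
  have z: "complete_quotient x (Suc (Suc n)) = z"
    unfolding z_def y_def by (rule complete_quotient_Suc_shift)
  obtain p q r s :: int where h: "p \<ge> 1" "q \<ge> 1" "r \<ge> 0" "s \<ge> 0" "\<bar>p * s - q * r\<bar> = 1" "z > 1"
      "y * (of_int q * z + of_int s) = of_int p * z + of_int r"
      "convergent_of y n = of_int p / of_int q"
    using Suc.IH[OF y] unfolding z_def by blast
  have c: "\<lfloor>x\<rfloor> \<ge> 1" using Suc.prems(2) by linarith
  define c where "c = \<lfloor>x\<rfloor>"
  have "x * (of_int p * z + of_int r) = (of_int c + 1 / y) * (y * (of_int q * z + of_int s))"
    using xy h(7) by (simp add: c_def)
  also have "\<dots> = (of_int c * y + 1) * (of_int q * z + of_int s)"
    using y(2) by (simp add: field_simps)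
  also have "\<dots> = of_int c * (y * (of_int q * z + of_int s)) + (of_int q * z + of_int s)"
    by (simp add: algebra_simps)
  also have "\<dots> = of_int (c * p + q) * z + of_int (c * r + s)"
    unfolding h(7) by (simp add: algebra_simps)
  finally have eq: "x * (of_int p * z + of_int r) = of_int (c * p + q) * z + of_int (c * r + s)" .
  have "convergent_of x (Suc n) = of_int c + 1 / convergent_of y n"
    unfolding c_def y_def by (rule convergent_of_Suc)
  then have conv: "convergent_of x (Suc n) = of_int (c * p + q) / of_int p"
    using h(1,2,8) by (simp add: field_simps)
  have "(c * p + q) * r - p * (c * r + s) = - (p * s - q * r)" by (simp add: algebra_simps)
  then have det: "\<bar>(c * p + q) * r - p * (c * r + s)\<bar> = 1" using h(5) by simp
  have "c * p \<ge> 0" "c * r \<ge> 0" using c h(1,3) by (simp_all add: c_def)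
  then have "c * p + q \<ge> 1" "c * r + s \<ge> 0" using h(2,4) by auto
  then show ?case
    unfolding z using h(1,3,6) eq conv det by blast
qed

text \<open>With \<open>z\<close> the next complete quotient, the product of \<open>q x - p\<close>
  and \<open>q z + s\<close> is a determinant, hence 1 in absolute value, and \<open>q z + s\<close>
  is at least \<open>q\<close>.\<close>

lemma convergent_of_approx:
  fixes x :: real
  assumes "x \<notin> \<rat>" "x > 1"
  obtains p q :: int where "p \<ge> 1" "q \<ge> 1" "convergent_of x n = of_int p / of_int q"
    "\<bar>of_int q * x - of_int p\<bar> * of_int q \<le> 1"
proof -
  obtain p q r s :: int and z :: real where h: "p \<ge> 1" "q \<ge> 1" "r \<ge> 0" "s \<ge> 0"
      "\<bar>p * s - q * r\<bar> = 1" "z > 1"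
      "x * (of_int q * z + of_int s) = of_int p * z + of_int r"
      "convergent_of x n = of_int p / of_int q"
    using convergent_of_matrix[OF assms] by blast
  have "(of_int q * x - of_int p) * (of_int q * z + of_int s)
      = of_int q * (x * (of_int q * z + of_int s)) - of_int p * (of_int q * z + of_int s)"
    by (simp add: algebra_simps)
  also have "\<dots> = of_int (q * r - p * s)"
    unfolding h(7) by (simp add: algebra_simps)
  finally have "\<bar>of_int q * x - of_int p\<bar> * \<bar>of_int q * z + of_int s\<bar> = of_int \<bar>q * r - p * s\<bar>"
    by (simp add: abs_mult[symmetric])
  then have 1: "\<bar>of_int q * x - of_int p\<bar> * \<bar>of_int q * z + of_int s\<bar> = 1"
    using h(5) by (simp add: abs_minus_commute)
  have "of_int q * z \<ge> of_int q * 1" using h(2,6) by (intro mult_left_mono) auto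
  then have "of_int q \<le> \<bar>of_int q * z + of_int s\<bar>" using h(4) by simp
  then have "\<bar>of_int q * x - of_int p\<bar> * of_int q \<le> 1"
    using 1 by (metis abs_ge_zero mult_left_mono)
  then show ?thesis using that h by blast
qed

text \<open>The hypothesis is weaker than the classical \<open>\<bar>x - u/v\<bar> < 1 / (2 v\<^sup>2)\<close>; unlike the latter,
  it is inherited by the complete quotient \<open>1 / (x - \<lfloor>x\<rfloor>)\<close> and the fraction \<open>v / (u mod v)\<close>.\<close>

lemma legendre_criterion_strong:
  fixes x :: real and u :: int and v :: nat
  assumes "coprime u (int v)" "v > 0"
    and "v = 1 \<Longrightarrow> x - of_int u > - 1 / 2"
    and "\<bar>of_nat v * x - of_int u\<bar> * (2 * of_nat v - 1) < 1"
  shows "\<exists>n. convergent_of x n = of_int u / of_nat v"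
  using assms
proof (induction v arbitrary: x u rule: less_induct)
  case (less v)
  show ?case
  proof (cases "v = 1")
    case True
    have h: "x - of_int u > - 1 / 2" "\<bar>x - of_int u\<bar> < 1"
      using less.prems(3,4) True by auto
    show ?thesis
    proof (cases "x \<ge> of_int u")
      case True
      then have "\<lfloor>x\<rfloor> = u" using h(2) by linarith
      then show ?thesis using \<open>v = 1\<close> by (intro exI[of _ 0]) (simp add: convergent_of_0)
    next
      case False
      \<comment> \<open>Now \<open>x\<close> lies between \<open>u - 1/2\<close> and
        \<open>u\<close>, so its expansion starts with \<open>[u - 1; 1]\<close>, whose value is
        \<open>u\<close>. The one-sided hypothesis for \<open>v = 1\<close> secures the partial
        quotient 1.\<close>
      have fl: "\<lfloor>x\<rfloor> = u - 1" using h False by linarith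
      define z where "z = x - of_int \<lfloor>x\<rfloor>"
      have "z > 1 / 2" "z < 1" using h False by (auto simp: z_def fl)
      then have "1 / z < 2" "1 \<le> 1 / z" by (auto simp: field_simps)
      then have "\<lfloor>1 / z\<rfloor> = 1" by linarith
      then have "convergent_of x (Suc 0) = of_int u"
        unfolding convergent_of_Suc convergent_of_0 z_def[symmetric] by (simp add: fl)
      then show ?thesis using \<open>v = 1\<close> by auto
    qed
  next
    case False
    then have v2: "v \<ge> 2" using less.prems(2) by auto
    define c where "c = u div int v"
    define w where "w = nat (u mod int v)"
    have w: "int w = u mod int v" using v2 by (simp add: w_def)
    have u: "u = c * int v + int w" unfolding w c_def by simp
    have "w < v" using w v2 by (metis of_nat_0_less_iff of_nat_less_iff less.prems(2) pos_mod_bound)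
    have cop: "coprime (int v) (int w)"
      using less.prems(1) unfolding w by (metis coprime_commute coprime_iff_gcd_eq_1 gcd_red_int)
    have "w \<noteq> 0" using cop v2 by (intro notI) simp
    then have w1: "w \<ge> 1" by simp
    define y where "y = x - of_int c"
    have bd: "\<bar>of_nat v * y - of_nat w\<bar> * (2 * of_nat v - 1) < 1"
      using less.prems(4) unfolding u y_def by (simp add: algebra_simps)
    have v3: "2 * real v - 1 > 0" using v2 by simp
    have bdl: "(of_nat w - of_nat v * y) * (2 * of_nat v - 1) < 1"
      and bdu: "(of_nat v * y - of_nat w) * (2 * of_nat v - 1) < 1"
      using bd v3 by (smt (verit, best) mult_right_mono)+
    have wv: "real w + 1 \<le> real v" "real w \<ge> 1" "real v \<ge> 2"
      using \<open>w < v\<close> w1 v2 by linarith+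
    \<comment> \<open>Passing from \<open>y\<close> to \<open>1 / y\<close> divides the error by
      \<open>y\<close>; this inequality lets the smaller factor \<open>2 w - 1\<close> absorb that
      loss. It rests on \<open>w + 1 <= v\<close>.\<close>
    have lower: "(2 * of_nat v - 1) * y > 2 * of_nat w - 1"
    proof -
      have "real v * ((2 * real v - 1) * y) > real w * (2 * real v - 1) - 1"
        using bdl by (simp add: algebra_simps)
      moreover have "real w * (2 * real v - 1) - 1 \<ge> real v * (2 * real w - 1)"
        using wv by (simp add: algebra_simps)
      ultimately have "real v * ((2 * real v - 1) * y) > real v * (2 * real w - 1)" by linarith
      then show ?thesis using v2 by simp
    qed
    have ypos: "y > 0"
      using lower wv by (smt (verit, best) mult_nonneg_nonpos)
    have ylt: "y < 1"
    proof (rule ccontr)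
      assume "\<not> y < 1"
      then have "real v * y \<ge> real v * 1" by (intro mult_left_mono) auto
      then have "real v * y - real w \<ge> 1" using wv by linarith
      then have "(real v * y - real w) * (2 * real v - 1) \<ge> 1 * (2 * real v - 1)"
        using v3 by (intro mult_right_mono) auto
      then have "1 * (2 * real v - 1) < 1" using bdu by (rule le_less_trans)
      then show False using wv(3) by simp
    qed
    have fl: "\<lfloor>x\<rfloor> = c" using ypos ylt unfolding y_def by linarith
    \<comment> \<open>The extra hypothesis for denominator 1 is regained from the upper half of the
      error bound.\<close>
    have "1 / y - of_int (int v) > - 1 / 2" if "w = 1"
    proof -
      have "real v * ((2 * real v - 1) * y) < real v * 2"
        using bdu that by (simp add: algebra_simps)
      then have "(2 * real v - 1) * y < 2" using v2 by simp
      then have "(real v - 1 / 2) * y < 1" by (simp add: algebra_simps)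
      then show ?thesis using ypos by (simp add: field_simps)
    qed
    moreover have "\<bar>of_nat w * (1 / y) - of_int (int v)\<bar> * (2 * of_nat w - 1) < 1"
    proof -
      have "real w * (1 / y) - real v = - ((real v * y - real w) / y)"
        using ypos by (simp add: field_simps)
      then have "\<bar>real w * (1 / y) - real v\<bar> = \<bar>real v * y - real w\<bar> / y"
        using ypos by simp
      then have "\<bar>real w * (1 / y) - real v\<bar> * (2 * real w - 1)
          = \<bar>real v * y - real w\<bar> * (2 * real w - 1) / y" by simp
      also have "\<dots> \<le> \<bar>real v * y - real w\<bar> * ((2 * real v - 1) * y) / y"
        using lower ypos by (intro divide_right_mono mult_left_mono) auto
      also have "\<dots> = \<bar>real v * y - real w\<bar> * (2 * real v - 1)" using ypos by simp
      finally show ?thesis using bd by simp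
    qed
    ultimately have "\<exists>n. convergent_of (1 / y) n = of_int (int v) / of_nat w"
      using less.IH[OF \<open>w < v\<close> cop, of "1 / y"] w1 by auto
    then obtain n where n: "convergent_of (1 / y) n = of_nat v / of_nat w" by auto
    have "convergent_of x (Suc n) = of_int c + of_nat w / of_nat v"
      unfolding convergent_of_Suc fl y_def[symmetric] n by simp
    also have "\<dots> = of_int u / of_nat v" using v2 by (simp add: u field_simps)
    finally show ?thesis by blast
  qed
qed

section \<open>Convergents of the square root of a non-square\<close>

lemma sqrt_nat_irrational:
  assumes "\<not> (\<exists>m :: nat. k = m\<^sup>2)"
  shows "sqrt (real k) \<notin> \<rat>"
proof
  assume "sqrt (real k) \<in> \<rat>"
  then obtain m n :: nat where mn: "n \<noteq> 0" "\<bar>sqrt (real k)\<bar> = real m / real n" "coprime m n"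
    by (rule Rats_abs_nat_div_natE)
  then have "real k = (real m / real n)\<^sup>2" by (metis abs_of_nonneg of_nat_0_le_iff real_sqrt_ge_zero real_sqrt_pow2)
  then have "real (k * n\<^sup>2) = real (m\<^sup>2)" using mn(1) by (simp add: power_divide)
  then have "k * n\<^sup>2 = m\<^sup>2" using of_nat_eq_iff by blast
  then have "n\<^sup>2 dvd m\<^sup>2" by (metis dvd_triv_right)
  then have "n dvd m" by simp
  then have "n = 1" using mn(3) by (metis coprime_absorb_right nat_dvd_1_iff_1)
  then show False using \<open>k * n\<^sup>2 = m\<^sup>2\<close> assms by auto
qed

text \<open>Factoring the norm gives \<open>\<bar>q s - p\<bar> (q s + p) = 1\<close> with
  \<open>s = sqrt k\<close>. Since \<open>p >= q\<close> and \<open>s > 1\<close>, the second factor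
  exceeds \<open>2 q\<close>, and Legendre's criterion applies.\<close>

lemma pellian_is_convergent:
  assumes "\<not> (\<exists>m :: nat. k = m\<^sup>2)" "is_pellian_convergent k y"
  shows "is_cfrac_convergent (sqrt (real k)) y"
proof -
  obtain p q :: nat where pq: "p > 0" "q > 0" "y = Fin (real p / real q)"
      "(int p)\<^sup>2 - int k * (int q)\<^sup>2 = 1 \<or> (int p)\<^sup>2 - int k * (int q)\<^sup>2 = - 1"
    using assms(2) unfolding is_pellian_convergent_def by blast
  define s where "s = sqrt (real k)"
  have s2: "s * s = real k" by (simp add: s_def)
  have "k \<noteq> 0" "k \<noteq> 1" using assms(1) by (metis zero_power2, metis one_power2)
  then have k2: "k \<ge> 2" by simp
  then have s1: "s > 1" unfolding s_def by simp
  have "\<bar>(int p)\<^sup>2 - int k * (int q)\<^sup>2\<bar> = 1" using pq(4) by auto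
  then have "\<bar>real_of_int ((int p)\<^sup>2 - int k * (int q)\<^sup>2)\<bar> = 1"
    by (metis of_int_1 of_int_abs)
  then have "\<bar>(real p)\<^sup>2 - real k * (real q)\<^sup>2\<bar> = 1" by simp
  moreover have "(real p)\<^sup>2 - real k * (real q)\<^sup>2 = - ((q * s - p) * (q * s + p))"
    unfolding s2[symmetric] by (simp add: algebra_simps power2_eq_square)
  ultimately have norm: "\<bar>q * s - p\<bar> * (q * s + p) = 1"
    using s1 by (simp add: abs_mult)
  \<comment> \<open>If \<open>p < q\<close>, then \<open>k >= 2\<close> pushes the norm below
    -1.\<close>
  have "p \<ge> q"
  proof (rule ccontr)
    assume "\<not> p \<ge> q"
    then have "int p + 1 \<le> int q" by simp
    then have "(int p + 1)\<^sup>2 \<le> (int q)\<^sup>2" by (intro power_mono) auto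
    moreover have "2 * (int q)\<^sup>2 \<le> int k * (int q)\<^sup>2" using k2 by (intro mult_right_mono) auto
    moreover have "(int p + 1)\<^sup>2 = (int p)\<^sup>2 + 2 * int p + 1" by (simp add: power2_eq_square algebra_simps)
    ultimately have "(int p)\<^sup>2 - int k * (int q)\<^sup>2 \<le> - 2 * int p - 1 - (int q)\<^sup>2" by linarith
    moreover have "(int q)\<^sup>2 \<ge> 0" by simp
    ultimately show False using pq(1,4) by linarith
  qed
  moreover have "real q * s > real q * 1" using s1 pq(2) by (intro mult_strict_left_mono) auto
  ultimately have big: "q * s + p > 2 * real q" by linarith
  have "\<bar>q * s - p\<bar> > 0" using norm by (metis abs_ge_zero abs_zero mult_zero_left less_eq_real_def zero_neq_one)
  then have lt: "\<bar>q * s - p\<bar> * (2 * real q) < 1"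
    using norm big mult_strict_left_mono by metis
  then have strong: "\<bar>of_nat q * s - of_int (int p)\<bar> * (2 * of_nat q - 1) < 1"
    using abs_ge_zero[of "q * s - p"] by (simp add: algebra_simps)
  have q1: "s - of_int (int p) > - 1 / 2" if "q = 1"
    using lt that by (simp add: abs_if split: if_splits)
  have "coprime (int p) (int q)"
  proof (rule coprimeI)
    fix c assume "c dvd int p" "c dvd int q"
    then have "c dvd (int p)\<^sup>2 - int k * (int q)\<^sup>2" by (simp add: power2_eq_square)
    then show "is_unit c" using pq(4) by auto
  qed
  from legendre_criterion_strong[OF this pq(2) q1 strong]
  obtain n where "convergent_of s n = of_int (int p) / of_nat q" by blast
  then show ?thesis unfolding is_cfrac_convergent_def using pq(3) by (auto simp: s_def intro!: exI[of _ n])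
qed

text \<open>With \<open>e = \<bar>q s - p\<bar>\<close>, the norm is at most
  \<open>e (2 q s + e)\<close> in absolute value, where \<open>e <= 1\<close> and
  \<open>e q <= 1\<close>. It is nonzero because \<open>s\<close> is irrational. What matters later
  is that the bound depends on \<open>k\<close> alone.\<close>

lemma convergent_norm_bound:
  assumes "\<not> (\<exists>m :: nat. k = m\<^sup>2)" "is_cfrac_convergent (sqrt (real k)) (Fin x)"
  obtains p q :: int where "p > 0" "q > 0" "x = of_int p / of_int q"
    "p\<^sup>2 - int k * q\<^sup>2 \<noteq> 0" "\<bar>p\<^sup>2 - int k * q\<^sup>2\<bar> \<le> 2 * int k + 1"
proof -
  define s where "s = sqrt (real k)"
  have s2: "s * s = real k" by (simp add: s_def)
  have "k \<noteq> 0" "k \<noteq> 1" using assms(1) by (metis zero_power2, metis one_power2)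
  then have s1: "s > 1" unfolding s_def by simp
  have irr: "s \<notin> \<rat>" unfolding s_def using assms(1) by (rule sqrt_nat_irrational)
  obtain n where n: "x = convergent_of s n"
    using assms(2) unfolding is_cfrac_convergent_def s_def by auto
  obtain p q :: int where pq: "p \<ge> 1" "q \<ge> 1" "convergent_of s n = of_int p / of_int q"
    "\<bar>of_int q * s - of_int p\<bar> * of_int q \<le> 1"
    using convergent_of_approx[OF irr s1] by blast
  have fac: "real_of_int (p\<^sup>2 - int k * q\<^sup>2) = - ((q * s - p) * (q * s + p))"
    using s2 by (simp add: algebra_simps power2_eq_square)
  have "s \<noteq> of_int p / of_int q" using irr by (metis Rats_divide Rats_of_int)
  then have "q * s - p \<noteq> 0" using pq(2) by (auto simp: field_simps)
  moreover have pos: "q * s + p > 0" using pq s1 by (intro add_pos_pos) auto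
  ultimately have "real_of_int (p\<^sup>2 - int k * q\<^sup>2) \<noteq> 0" unfolding fac by simp
  then have nz: "p\<^sup>2 - int k * q\<^sup>2 \<noteq> 0" by (metis of_int_0)
  define e where "e = \<bar>of_int q * s - of_int p\<bar>"
  have "e * 1 \<le> e * of_int q" using pq(2) by (intro mult_left_mono) (auto simp: e_def)
  then have e: "e \<ge> 0" "e \<le> 1" "e * of_int q \<le> 1" using pq(4) by (auto simp: e_def)
  have "real_of_int \<bar>p\<^sup>2 - int k * q\<^sup>2\<bar> = e * (q * s + p)"
    unfolding of_int_abs fac e_def using pos by (simp add: abs_mult)
  also have "\<dots> \<le> e * (2 * (q * s) + e)"
    using e(1) unfolding e_def by (intro mult_left_mono; linarith)
  also have "\<dots> = 2 * s * (e * q) + e * e" by (simp add: algebra_simps)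
  also have "\<dots> \<le> 2 * s * 1 + 1 * 1"
    using e s1 by (intro add_mono mult_left_mono mult_mono) auto
  \<comment> \<open>The estimate is weakened from \<open>2 s + 1\<close> to reach an
    integer.\<close>
  also have "\<dots> \<le> 2 * (s * s) + 1" using s1 by simp
  finally have "real_of_int \<bar>p\<^sup>2 - int k * q\<^sup>2\<bar> \<le> real_of_int (2 * int k + 1)" using s2 by simp
  then have "\<bar>p\<^sup>2 - int k * q\<^sup>2\<bar> \<le> 2 * int k + 1" by (simp only: of_int_le_iff)
  then show ?thesis using that[of p q] pq n nz by auto
qed

section \<open>Powers of an element of norm one\<close>

text \<open>Both \<open>u\<close> and \<open>v\<close> are roots of
  \<open>X^2 - (u + v) X + 1\<close>. The power sums are the traces of the powers of
  \<open>u\<close>.\<close>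

lemma power_sum_rec:
  fixes u v :: "'a :: comm_ring_1"
  assumes "u * v = 1"
  shows "u ^ Suc (Suc n) + v ^ Suc (Suc n) = (u + v) * (u ^ Suc n + v ^ Suc n) - (u ^ n + v ^ n)"
proof -
  have "(u + v) * (u ^ Suc n + v ^ Suc n)
      = u ^ Suc (Suc n) + v ^ Suc (Suc n) + (u * v) * (u ^ n + v ^ n)"
    by (simp add: algebra_simps)
  then show ?thesis using assms by simp
qed

lemma power_diff_rec:
  fixes u v :: "'a :: comm_ring_1"
  assumes "u * v = 1"
  shows "u ^ Suc (Suc n) - v ^ Suc (Suc n) = (u + v) * (u ^ Suc n - v ^ Suc n) - (u ^ n - v ^ n)"
proof -
  have "(u + v) * (u ^ Suc n - v ^ Suc n)
      = u ^ Suc (Suc n) - v ^ Suc (Suc n) + (u * v) * (u ^ n - v ^ n)"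
    by (simp add: algebra_simps)
  then show ?thesis using assms by simp
qed

lemma power_sum_in_Ints:
  fixes u v :: real
  assumes "u * v = 1" "u + v \<in> \<int>"
  shows "u ^ n + v ^ n \<in> \<int>"
proof -
  have "u ^ n + v ^ n \<in> \<int> \<and> u ^ Suc n + v ^ Suc n \<in> \<int>"
  proof (induction n)
    case 0
    then show ?case using assms by simp
  next
    case (Suc n)
    then show ?case
      unfolding power_sum_rec[OF assms(1)] using assms(2) by (auto intro: Ints_mult Ints_diff)
  qed
  then show ?thesis by simp
qed

text \<open>If \<open>a\<close> and \<open>y\<close> are coprime, then so are \<open>w\<close> and \<open>y\<close>: the denominator of the trace of \<open>u\<^sup>n\<close>
  is exactly \<open>y\<^sup>n\<close>.\<close>

lemma power_sum_denominator:
  fixes u v :: real and a y :: int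
  assumes "u * v = 1" "u + v = of_int a / of_int y" "y \<noteq> 0"
  shows "\<exists>w z. of_int y ^ Suc n * (u ^ Suc n + v ^ Suc n) = of_int w \<and> w = a ^ Suc n + y * z"
proof -
  \<comment> \<open>Clearing denominators gives an integral recurrence which modulo \<open>y\<close>
    reads \<open>W (n + 1) = a W n\<close>. The congruence with powers of \<open>a\<close> starts at
    index 1, because \<open>W 0 = 2\<close>.\<close>
  define W where "W n = of_int y ^ n * (u ^ n + v ^ n)" for n
  have W: "W (Suc (Suc n)) = of_int a * W (Suc n) - of_int (y\<^sup>2) * W n" for n
    unfolding W_def power_sum_rec[OF assms(1)] assms(2)
    using assms(3) by (simp add: field_simps power2_eq_square)
  have W0: "W 0 = 2" and W1: "W (Suc 0) = of_int a"
    using assms(2,3) by (simp_all add: W_def)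
  have "\<exists>w z w' z'. W (Suc n) = of_int w \<and> w = a ^ Suc n + y * z \<and>
          W (Suc (Suc n)) = of_int w' \<and> w' = a ^ Suc (Suc n) + y * z'"
  proof (induction n)
    case 0
    show ?case unfolding W W1 W0
      by (intro exI[of _ a] exI[of _ 0] exI[of _ "a\<^sup>2 - y\<^sup>2 * 2"] exI[of _ "- 2 * y"])
        (simp add: power2_eq_square)
  next
    case (Suc n)
    then obtain w z w' z' where h: "W (Suc n) = of_int w" "w = a ^ Suc n + y * z"
      "W (Suc (Suc n)) = of_int w'" "w' = a ^ Suc (Suc n) + y * z'" by blast
    have "W (Suc (Suc (Suc n))) = of_int (a * w' - y\<^sup>2 * w)"
      unfolding W[of "Suc n"] h(1,3) by simp
    moreover have "a * w' - y\<^sup>2 * w = a ^ Suc (Suc (Suc n)) + y * (a * z' - y * w)"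
      unfolding h(4) by (simp add: algebra_simps power2_eq_square)
    ultimately show ?case using h(3,4) by blast
  qed
  then show ?thesis unfolding W_def by blast
qed

text \<open>The Lucas sequence U_n with parameters t and 1.\<close>

fun lucas_seq :: "int \<Rightarrow> nat \<Rightarrow> int" where
  "lucas_seq t 0 = 0"
| "lucas_seq t (Suc 0) = 1"
| "lucas_seq t (Suc (Suc n)) = t * lucas_seq t (Suc n) - lucas_seq t n"

text \<open>Binet's formula, cleared of the denominator \<open>u - v\<close>.\<close>

lemma lucas_seq_power_diff:
  fixes u v :: real
  assumes "u * v = 1" "u + v = of_int t"
  shows "u ^ n - v ^ n = (u - v) * of_int (lucas_seq t n)"
  using assms(2)
proof (induction t n rule: lucas_seq.induct)
  case (3 t n)
  have "u ^ Suc (Suc n) - v ^ Suc (Suc n)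
      = of_int t * ((u - v) * of_int (lucas_seq t (Suc n))) - (u - v) * of_int (lucas_seq t n)"
    unfolding power_diff_rec[OF assms(1)] 3(3) using 3(1,2)[OF 3(3)] by metis
  then show ?case by (simp add: algebra_simps)
qed simp_all

text \<open>By pigeonhole two pairs of consecutive residues modulo \<open>M\<close> agree. The
  earlier term has coefficient -1, so the recurrence also runs backwards, and the coincidence
  descends to index 0, where the term is 0.\<close>

lemma lucas_seq_dvd:
  fixes M t :: int
  assumes "M > 0"
  shows "\<exists>m>0. M dvd lucas_seq t m"
proof -
  define g where "g m = (lucas_seq t m mod M, lucas_seq t (Suc m) mod M)" for m
  have "g ` UNIV \<subseteq> {0..<M} \<times> {0..<M}" using assms by (auto simp: g_def)
  then have "finite (range g)" by (rule finite_subset) auto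
  then have "\<not> inj g" using finite_imageD infinite_UNIV_nat by blast
  then obtain i j where ij: "i < j" "g i = g j"
    unfolding inj_def by (metis linorder_neqE_nat)
  obtain l where l: "j = l + i" "l > 0" using ij(1) by (metis add.commute less_imp_add_positive)
  have "M dvd lucas_seq t i - lucas_seq t (l + i)
      \<and> M dvd lucas_seq t (Suc i) - lucas_seq t (Suc (l + i))"
    using ij(2) l(1) by (simp add: g_def mod_eq_dvd_iff)
  then have "M dvd lucas_seq t 0 - lucas_seq t l"
  proof (induction i)
    case (Suc i)
    have "lucas_seq t i - lucas_seq t (l + i)
        = t * (lucas_seq t (Suc i) - lucas_seq t (l + Suc i))
          - (lucas_seq t (Suc (Suc i)) - lucas_seq t (Suc (l + Suc i)))"
      by (simp add: algebra_simps)
    then show ?case using Suc by (metis add_Suc_right dvd_diff dvd_mult)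
  qed simp
  then show ?thesis using l(2) by auto
qed

section \<open>The orbit of infinity\<close>

text \<open>This is the conjugation of the map to multiplication by \<open>u\<close>, with
  denominators cleared. Positivity of \<open>x\<close> is carried along to keep the orbit away from
  the pole \<open>- d\<close>.\<close>

lemma moebius_orbit:
  fixes d s :: real
  assumes "d > 0" "s > 0" "d \<noteq> s" "n \<ge> 1"
  shows "\<exists>x>0. (moebius d (s\<^sup>2) ^^ n) Infty = Fin x \<and> x + s = ((d + s) / (d - s)) ^ n * (x - s)"
  using assms(4)
proof (induction n rule: nat_induct_at_least)
  case base
  then show ?case using assms(1,3) by simp
next
  case (Suc n)
  then obtain x where x: "x > 0" "(moebius d (s\<^sup>2) ^^ n) Infty = Fin x"
    "x + s = ((d + s) / (d - s)) ^ n * (x - s)" by blast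
  let ?y = "(d * x + s\<^sup>2) / (x + d)"
  have nz: "x + d > 0" using x(1) assms(1) by simp
  then have "?y + s = (d + s) * (x + s) / (x + d)"
    by (simp add: field_simps power2_eq_square)
  also have "\<dots> = (d + s) * ((d + s) / (d - s)) ^ n * (x - s) / (x + d)" by (simp add: x(3))
  also have "\<dots> = ((d + s) / (d - s)) ^ Suc n * ((d - s) * (x - s) / (x + d))"
    using assms(3) by simp
  also have "(d - s) * (x - s) / (x + d) = ?y - s"
    using nz by (simp add: field_simps power2_eq_square)
  finally have "?y + s = ((d + s) / (d - s)) ^ Suc n * (?y - s)" .
  moreover have "?y > 0" using x(1) assms(1,2) by (intro divide_pos_pos add_pos_pos) auto
  moreover have "(moebius d (s\<^sup>2) ^^ Suc n) Infty = Fin ?y" using x(2) nz by simp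
  ultimately show ?case by blast
qed

text \<open>Reads the iterate off from \<open>u^n\<close>: eliminating \<open>u^n\<close> between
  the hypothesis and the orbit equation leaves \<open>2 s (x q - p) = 0\<close>.\<close>

lemma moebius_orbit_eq:
  fixes d s p q :: real
  assumes "d > 0" "s > 0" "d \<noteq> s" "n \<ge> 1"
    and "((d + s) / (d - s)) ^ n * (p - q * s) = p + q * s" "p \<noteq> 0 \<or> q \<noteq> 0"
  shows "q \<noteq> 0" "p / q > 0" "(moebius d (s\<^sup>2) ^^ n) Infty = Fin (p / q)"
proof -
  define w where "w = ((d + s) / (d - s)) ^ n"
  obtain x where x: "x > 0" "(moebius d (s\<^sup>2) ^^ n) Infty = Fin x" "x + s = w * (x - s)"
    using moebius_orbit[OF assms(1-4)] unfolding w_def by blast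
  have "(x + s) * (p - q * s) = (x - s) * (w * (p - q * s))" unfolding x(3) by simp
  also have "\<dots> = (x - s) * (p + q * s)" using assms(5) by (simp add: w_def)
  finally have "2 * s * (x * q - p) = 0" by (auto simp: algebra_simps)
  then have xq: "x * q = p" using assms(2) by simp
  then show "q \<noteq> 0" using assms(6) by auto
  then have "x = p / q" using xq by (simp add: field_simps)
  then show "p / q > 0" "(moebius d (s\<^sup>2) ^^ n) Infty = Fin (p / q)" using x by auto
qed

text \<open>For \<open>s^2 = k\<close> the right-hand side is -2 - R, so R is an integer exactly
  when the trace of \<open>u\<close> is one.\<close>

lemma norm_one_trace:
  fixes d s :: real
  assumes "d - s \<noteq> 0" "d + s \<noteq> 0"
  shows "(d + s) / (d - s) + (d - s) / (d + s) = - 2 - 4 * d\<^sup>2 / (s\<^sup>2 - d\<^sup>2)"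
proof -
  have "s\<^sup>2 - d\<^sup>2 = - ((d - s) * (d + s))" by (simp add: algebra_simps power2_eq_square)
  then have "- 2 - 4 * d\<^sup>2 / (s\<^sup>2 - d\<^sup>2) = - 2 + 4 * d\<^sup>2 / ((d - s) * (d + s))"
    by (metis diff_minus_eq_add divide_minus_right)
  also have "\<dots> = (- 2 * ((d - s) * (d + s)) + 4 * d\<^sup>2) / ((d - s) * (d + s))"
    using assms by (subst add_divide_distrib) simp
  also have "- 2 * ((d - s) * (d + s)) + 4 * d\<^sup>2 = (d + s) * (d + s) + (d - s) * (d - s)"
    by (simp add: algebra_simps power2_eq_square)
  finally show ?thesis using add_frac_eq[OF assms] by simp
qed

lemma norm_one_diff:
  fixes d s :: real
  assumes "d - s \<noteq> 0" "d + s \<noteq> 0"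
  shows "(d + s) / (d - s) - (d - s) / (d + s) = 2 * (- 2 * d / (s\<^sup>2 - d\<^sup>2)) * s"
proof -
  have "s\<^sup>2 - d\<^sup>2 = - ((d - s) * (d + s))" by (simp add: algebra_simps power2_eq_square)
  then have "2 * (- 2 * d / (s\<^sup>2 - d\<^sup>2)) * s = 4 * d * s / ((d - s) * (d + s))" by simp
  also have "4 * d * s = (d + s) * (d + s) - (d - s) * (d - s)" by (simp add: algebra_simps)
  finally show ?thesis using diff_frac_eq[OF assms] by simp
qed

section \<open>The implications between (a), (b) and (c)\<close>

lemma integral_trace_imp_pellian:
  fixes d :: real
  assumes nsq: "\<not> (\<exists>m :: nat. k = m\<^sup>2)" and "d \<in> \<rat>" "d > 0"
    and R: "4 * d\<^sup>2 / (real k - d\<^sup>2) \<in> \<int>"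
  shows "\<exists>n\<ge>1. is_pellian_convergent k ((moebius d (real k) ^^ n) Infty)"
proof -
  define s where "s = sqrt (real k)"
  have s2: "s\<^sup>2 = real k" by (simp add: s_def)
  have irr: "s \<notin> \<rat>" unfolding s_def using nsq by (rule sqrt_nat_irrational)
  have "k \<noteq> 0" using nsq by (metis zero_power2)
  then have s0: "s > 0" by (simp add: s_def)
  have ds: "d \<noteq> s" using irr \<open>d \<in> \<rat>\<close> by auto
  define u v where "u = (d + s) / (d - s)" and "v = (d - s) / (d + s)"
  have nz: "d - s \<noteq> 0" "d + s \<noteq> 0" using ds s0 \<open>d > 0\<close> by auto
  have uv: "u * v = 1" using nz by (simp add: u_def v_def)
  have "u + v = - 2 - 4 * d\<^sup>2 / (real k - d\<^sup>2)"
    unfolding u_def v_def s2[symmetric] using nz by (rule norm_one_trace)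
  then have "u + v \<in> \<int>" using R by simp
  then obtain t where t: "u + v = of_int t" by (auto elim: Ints_cases)
  define b where "b = - 2 * d / (real k - d\<^sup>2)"
  have umv: "u - v = 2 * b * s"
    unfolding b_def u_def v_def s2[symmetric] using nz by (rule norm_one_diff)
  have "b \<in> \<rat>" unfolding b_def using \<open>d \<in> \<rat>\<close> by (intro Rats_divide Rats_mult Rats_diff) auto
  then obtain b1 b2 :: int where b: "b2 > 0" "b = of_int b1 / of_int b2"
    by (metis Rats_cases')
  \<comment> \<open>The index \<open>m\<close> is chosen so that the Lucas term cancels the
    denominator of \<open>b\<close>, making \<open>u^m - v^m\<close> an integral multiple of
    \<open>2 s\<close>.\<close>
  obtain m where m: "m > 0" "b2 dvd lucas_seq t m" using lucas_seq_dvd[OF b(1)] by blast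
  then obtain l where l: "lucas_seq t m = b2 * l" by blast
  define q where "q = b1 * l"
  have q: "u ^ m - v ^ m = 2 * of_int q * s"
    unfolding lucas_seq_power_diff[OF uv t] umv l q_def b(2) using b(1) by simp
  obtain V where V: "u ^ m + v ^ m = of_int V"
    using power_sum_in_Ints[OF uv \<open>u + v \<in> \<int>\<close>] by (auto elim: Ints_cases)
  \<comment> \<open>This identity both forces the integer trace \<open>V\<close> to be even and
    yields the Pell equation.\<close>
  have "(u ^ m + v ^ m)\<^sup>2 = (u ^ m - v ^ m)\<^sup>2 + 4 * (u * v) ^ m"
    by (simp add: power2_eq_square algebra_simps power_mult_distrib)
  then have "real_of_int (V\<^sup>2) = real_of_int (4 * (int k * q\<^sup>2 + 1))"
    unfolding V q uv using s2 by (simp add: power_mult_distrib)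
  then have V2: "V\<^sup>2 = 4 * (int k * q\<^sup>2 + 1)" by (simp only: of_int_eq_iff)
  then have "even (V\<^sup>2)" by simp
  then have "even V" by simp
  then obtain p where p: "V = 2 * p" by blast
  have norm: "p\<^sup>2 - int k * q\<^sup>2 = 1" using V2 unfolding p by (simp add: power_mult_distrib)
  have "u ^ m = of_int p + of_int q * s" "v ^ m = of_int p - of_int q * s"
    using V q unfolding p by (simp_all add: algebra_simps)
  \<comment> \<open>The exponent doubles because the quotient of \<open>p + q s\<close> by its
    conjugate is \<open>u^m / v^m = u^(2 m)\<close>.\<close>
  moreover have "u ^ (2 * m) * v ^ m = u ^ m * (u * v) ^ m"
    by (simp add: mult_2 power_add power_mult_distrib)
  ultimately have eq: "u ^ (2 * m) * (of_int p - of_int q * s) = of_int p + of_int q * s"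
    using uv by simp
  have "real_of_int p \<noteq> 0 \<or> real_of_int q \<noteq> 0" using norm by auto
  note orb = moebius_orbit_eq[OF \<open>d > 0\<close> s0 ds _ eq[unfolded u_def] this]
  have m2: "2 * m \<ge> 1" using m(1) by simp
  have "q \<noteq> 0" using orb(1)[OF m2] by simp
  have pq: "real_of_int p / real_of_int q > 0" using orb(2)[OF m2] .
  then have "p \<noteq> 0" by auto
  \<comment> \<open>Only the quotient is known to be positive; \<open>p\<close> and \<open>q\<close>
    may both be negative.\<close>
  have "real_of_int p / real_of_int q = \<bar>real_of_int p / real_of_int q\<bar>" using pq by (rule abs_of_pos[symmetric])
  then have "(moebius d (real k) ^^ (2 * m)) Infty = Fin (real (nat \<bar>p\<bar>) / real (nat \<bar>q\<bar>))"
    using orb(3)[OF m2] by (simp add: s2)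
  then have "is_pellian_convergent k ((moebius d (real k) ^^ (2 * m)) Infty)"
    unfolding is_pellian_convergent_def using \<open>p \<noteq> 0\<close> \<open>q \<noteq> 0\<close> norm
    by (intro exI[of _ "nat \<bar>p\<bar>"] exI[of _ "nat \<bar>q\<bar>"]) auto
  then show ?thesis using m2 by blast
qed

text \<open>Brahmagupta's composition, iterated. Exponents start at 1, since the zeroth power would
  give \<open>q' = 0\<close>.\<close>

lemma pell_power:
  fixes p q k :: nat and s :: real
  assumes "p > 0" "q > 0" "s\<^sup>2 = real k"
  shows "\<exists>p' q' :: nat. p' > 0 \<and> q' > 0 \<and>
      (int p')\<^sup>2 - int k * (int q')\<^sup>2 = ((int p)\<^sup>2 - int k * (int q)\<^sup>2) ^ Suc m \<and>
      real p' + real q' * s = (real p + real q * s) ^ Suc m \<and>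
      real p' - real q' * s = (real p - real q * s) ^ Suc m"
proof (induction m)
  case 0
  then show ?case using assms by auto
next
  case (Suc m)
  then obtain p' q' where h: "p' > 0" "q' > 0"
      "(int p')\<^sup>2 - int k * (int q')\<^sup>2 = ((int p)\<^sup>2 - int k * (int q)\<^sup>2) ^ Suc m"
      "real p' + real q' * s = (real p + real q * s) ^ Suc m"
      "real p' - real q' * s = (real p - real q * s) ^ Suc m" by blast
  let ?p = "p * p' + k * q * q'" and ?q = "p * q' + q * p'"
  have "(int ?p)\<^sup>2 - int k * (int ?q)\<^sup>2
      = ((int p)\<^sup>2 - int k * (int q)\<^sup>2) * ((int p')\<^sup>2 - int k * (int q')\<^sup>2)"
    by (simp add: algebra_simps power2_eq_square)
  then have "(int ?p)\<^sup>2 - int k * (int ?q)\<^sup>2 = ((int p)\<^sup>2 - int k * (int q)\<^sup>2) ^ Suc (Suc m)"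
    unfolding h(3) by simp
  moreover have "real ?p + real ?q * s = (real p + real q * s) * (real p' + real q' * s)"
    "real ?p - real ?q * s = (real p - real q * s) * (real p' - real q' * s)"
    unfolding of_nat_add of_nat_mult assms(3)[symmetric]
    by (simp_all add: algebra_simps power2_eq_square)
  then have "real ?p + real ?q * s = (real p + real q * s) ^ Suc (Suc m)"
    "real ?p - real ?q * s = (real p - real q * s) ^ Suc (Suc m)"
    unfolding h(4,5) by simp_all
  moreover have "?p > 0" "?q > 0" using assms h(1,2) by auto
  ultimately show ?case by blast
qed

lemma pellian_imp_infinitely_many_convergents:
  fixes d :: real
  assumes nsq: "\<not> (\<exists>m :: nat. k = m\<^sup>2)" and "d \<in> \<rat>" "d > 0"
    and n: "n \<ge> 1" "is_pellian_convergent k ((moebius d (real k) ^^ n) Infty)"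
  shows "infinite {n. n \<ge> 1 \<and> is_cfrac_convergent (sqrt (real k)) ((moebius d (real k) ^^ n) Infty)}"
    (is "infinite ?A")
proof -
  define s where "s = sqrt (real k)"
  have s2: "s\<^sup>2 = real k" by (simp add: s_def)
  have irr: "s \<notin> \<rat>" unfolding s_def using nsq by (rule sqrt_nat_irrational)
  have "k \<noteq> 0" using nsq by (metis zero_power2)
  then have s0: "s > 0" by (simp add: s_def)
  have ds: "d \<noteq> s" using irr \<open>d \<in> \<rat>\<close> by auto
  define u where "u = (d + s) / (d - s)"
  obtain p q :: nat where pq: "p > 0" "q > 0" "(moebius d (real k) ^^ n) Infty = Fin (real p / real q)"
      "(int p)\<^sup>2 - int k * (int q)\<^sup>2 = 1 \<or> (int p)\<^sup>2 - int k * (int q)\<^sup>2 = - 1"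
    using n(2) unfolding is_pellian_convergent_def by blast
  have "real p / real q + s = u ^ n * (real p / real q - s)"
    using moebius_orbit[OF \<open>d > 0\<close> s0 ds n(1)] pq(3) unfolding s2 u_def by auto
  then have un: "u ^ n * (real p - real q * s) = real p + real q * s"
    using pq(2) by (simp add: field_simps)
  \<comment> \<open>Raising the equation for \<open>u^n\<close> to the power \<open>m + 1\<close>
    replaces \<open>p + q s\<close> by its power, whose norm is still 1 or -1.\<close>
  have "n * Suc m \<in> ?A" for m
  proof -
    obtain p' q' :: nat where h: "p' > 0" "q' > 0"
      "(int p')\<^sup>2 - int k * (int q')\<^sup>2 = ((int p)\<^sup>2 - int k * (int q)\<^sup>2) ^ Suc m"
      "real p' + real q' * s = (real p + real q * s) ^ Suc m"
      "real p' - real q' * s = (real p - real q * s) ^ Suc m"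
      using pell_power[OF pq(1,2) s2] by blast
    have "u ^ (n * Suc m) * (real p' - real q' * s) = (u ^ n * (real p - real q * s)) ^ Suc m"
      unfolding h(5) power_mult power_mult_distrib ..
    then have eq: "u ^ (n * Suc m) * (real p' - real q' * s) = real p' + real q' * s"
      unfolding un h(4) .
    have nm: "n * Suc m \<ge> 1" using n(1) by simp
    have "(moebius d (s\<^sup>2) ^^ (n * Suc m)) Infty = Fin (real p' / real q')"
      using moebius_orbit_eq(3)[OF \<open>d > 0\<close> s0 ds nm eq[unfolded u_def]] h(1) by simp
    moreover have "(int p')\<^sup>2 - int k * (int q')\<^sup>2 = 1 \<or> (int p')\<^sup>2 - int k * (int q')\<^sup>2 = - 1"
      unfolding h(3) using pq(4) by (metis power_one minus_one_power_iff)
    ultimately have "is_pellian_convergent k ((moebius d (real k) ^^ (n * Suc m)) Infty)"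
      unfolding is_pellian_convergent_def s2 using h(1,2) by blast
    then show ?thesis using pellian_is_convergent[OF nsq] nm by blast
  qed
  then have "range (\<lambda>m. n * Suc m) \<subseteq> ?A" by blast
  moreover have "infinite (range (\<lambda>m. n * Suc m))"
    using n(1) by (subst finite_image_iff) (auto simp: inj_on_def)
  ultimately show ?thesis using infinite_super by blast
qed

lemma infinitely_many_convergents_imp_integral:
  fixes d :: real
  assumes nsq: "\<not> (\<exists>m :: nat. k = m\<^sup>2)" and "d \<in> \<rat>" "d > 0"
    and inf: "infinite {n. n \<ge> 1 \<and> is_cfrac_convergent (sqrt (real k)) ((moebius d (real k) ^^ n) Infty)}"
  shows "4 * d\<^sup>2 / (real k - d\<^sup>2) \<in> \<int>"
proof -
  define s where "s = sqrt (real k)"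
  have s2: "s\<^sup>2 = real k" by (simp add: s_def)
  have irr: "s \<notin> \<rat>" unfolding s_def using nsq by (rule sqrt_nat_irrational)
  have "k \<noteq> 0" using nsq by (metis zero_power2)
  then have s0: "s > 0" by (simp add: s_def)
  have ds: "d \<noteq> s" using irr \<open>d \<in> \<rat>\<close> by auto
  define u v where "u = (d + s) / (d - s)" and "v = (d - s) / (d + s)"
  have nz: "d - s \<noteq> 0" "d + s \<noteq> 0" using ds s0 \<open>d > 0\<close> by auto
  have uv: "u * v = 1" using nz by (simp add: u_def v_def)
  have tr: "u + v = - 2 - 4 * d\<^sup>2 / (real k - d\<^sup>2)"
    unfolding u_def v_def s2[symmetric] using nz by (rule norm_one_trace)
  have "u + v \<in> \<rat>" unfolding tr using \<open>d \<in> \<rat>\<close>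
    by (intro Rats_divide Rats_mult Rats_diff Rats_power) auto
  then obtain a y :: int where ay: "y > 0" "coprime a y" "u + v = of_int a / of_int y"
    by (metis Rats_cases')
  \<comment> \<open>A common multiple of all norms that convergents can have, independent of
    \<open>n\<close>.\<close>
  define M :: int where "M = fact (2 * k + 1)"
  have M0: "M > 0" by (simp add: M_def)
  have dvdM: "y ^ n dvd M"
    if n: "n \<ge> 1" "is_cfrac_convergent (sqrt (real k)) ((moebius d (real k) ^^ n) Infty)" for n
  proof -
    obtain x where x: "x > 0" "(moebius d (real k) ^^ n) Infty = Fin x" "x + s = u ^ n * (x - s)"
      using moebius_orbit[OF \<open>d > 0\<close> s0 ds n(1)] unfolding s2 u_def by blast
    obtain p q :: int where pq: "p > 0" "q > 0" "x = of_int p / of_int q"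
      "p\<^sup>2 - int k * q\<^sup>2 \<noteq> 0" "\<bar>p\<^sup>2 - int k * q\<^sup>2\<bar> \<le> 2 * int k + 1"
      using convergent_norm_bound[OF nsq] n(2) x(2) by metis
    define D where "D = p\<^sup>2 - int k * q\<^sup>2"
    have "nat \<bar>D\<bar> \<ge> 1" "nat \<bar>D\<bar> \<le> 2 * k + 1" using pq(4,5) unfolding D_def by linarith+
    then have "nat \<bar>D\<bar> dvd fact (2 * k + 1)" by (intro dvd_fact)
    then have "int (nat \<bar>D\<bar>) dvd int (fact (2 * k + 1))" by (simp only: int_dvd_int_iff)
    then have "D dvd M" unfolding M_def by (simp del: fact_Suc add: of_nat_fact)
    then obtain e where e: "M = D * e" by blast
    let ?P = "real_of_int p" and ?Q = "real_of_int q"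
    have Dfac: "real_of_int D = (?P + ?Q * s) * (?P - ?Q * s)"
      using s2 by (simp add: D_def algebra_simps power2_eq_square)
    have eq: "u ^ n * (?P - ?Q * s) = ?P + ?Q * s"
      using x(3) pq(2) unfolding pq(3) by (simp add: field_simps)
    have "v ^ n * (?P + ?Q * s) = (u * v) ^ n * (?P - ?Q * s)"
      unfolding eq[symmetric] by (simp add: power_mult_distrib)
    then have eq': "v ^ n * (?P + ?Q * s) = ?P - ?Q * s" by (simp add: uv)
    \<comment> \<open>Multiplied by the norm \<open>D\<close>, the trace becomes the sum of the
      squares of \<open>p + q s\<close> and its conjugate, an integer.\<close>
    have "(u ^ n + v ^ n) * of_int D = (u ^ n * (?P - ?Q * s)) * (?P + ?Q * s)
        + (v ^ n * (?P + ?Q * s)) * (?P - ?Q * s)"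
      unfolding Dfac by (simp add: algebra_simps)
    also have "\<dots> = of_int (2 * (p\<^sup>2 + int k * q\<^sup>2))"
      unfolding eq eq' using s2 by (simp add: algebra_simps power2_eq_square)
    finally have trD: "(u ^ n + v ^ n) * of_int D = of_int (2 * (p\<^sup>2 + int k * q\<^sup>2))" .
    obtain w z where w: "of_int y ^ n * (u ^ n + v ^ n) = of_int w" "w = a ^ n + y * z"
      using power_sum_denominator[OF uv ay(3), of "n - 1"] ay(1) n(1) by auto
    have "real_of_int (w * M) = of_int y ^ n * ((u ^ n + v ^ n) * of_int D) * of_int e"
      unfolding e of_int_mult w(1)[symmetric] by simp
    also have "\<dots> = real_of_int (y ^ n * (2 * (p\<^sup>2 + int k * q\<^sup>2) * e))"
      unfolding trD by simp
    finally have "w * M = y ^ n * (2 * (p\<^sup>2 + int k * q\<^sup>2) * e)" by (simp only: of_int_eq_iff)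
    then have "y ^ n dvd w * M" by simp
    \<comment> \<open>Modulo \<open>y\<close>, \<open>w\<close> is \<open>a^n\<close>, and
      \<open>a\<close> is coprime to \<open>y\<close>.\<close>
    moreover have "coprime w y"
    proof -
      have "coprime (a ^ n) y" using ay(2) by simp
      then show ?thesis unfolding w(2)
        by (metis add.commute coprime_iff_gcd_eq_1 gcd.commute gcd_add_mult mult.commute)
    qed
    then have "coprime (y ^ n) w" by (simp add: coprime_commute)
    ultimately show ?thesis by (simp add: coprime_dvd_mult_right_iff)
  qed
  have "y = 1"
  proof (rule ccontr)
    assume "y \<noteq> 1"
    then have y2: "y \<ge> 2" using ay(1) by simp
    \<comment> \<open>An infinite set of indices is unbounded; beyond \<open>M\<close>, already
      \<open>2^n\<close> is too large to divide \<open>M\<close>.\<close>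
    obtain n where n: "n > nat M" "n \<ge> 1"
        "is_cfrac_convergent (sqrt (real k)) ((moebius d (real k) ^^ n) Infty)"
      using inf unfolding finite_nat_set_iff_bounded_le by (auto simp: not_le)
    have "y ^ n \<le> M" using dvdM[OF n(2,3)] M0 by (rule zdvd_imp_le)
    moreover have "(2::int) ^ n \<le> y ^ n" using y2 by (intro power_mono) auto
    moreover have "int n < 2 ^ n" by (metis less_exp of_nat_less_iff of_nat_numeral of_nat_power)
    ultimately show False using n(1) by linarith
  qed
  then have "u + v = of_int a" using ay(3) by simp
  then have "4 * d\<^sup>2 / (real k - d\<^sup>2) = of_int (- 2 - a)" using tr by simp
  then show ?thesis by (metis Ints_of_int)
qed

text \<open>The three implications (a) to (b), (b) to (c) and (c) to (a) close a cycle.\<close>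

theorem theorem2p2:
  fixes k :: nat and d :: real
  assumes "k > 0"
    and "\<not> (\<exists>m :: nat. k = m\<^sup>2)"
    and "d \<in> \<rat>"
    and "d > 0"
  shows "(4 * d\<^sup>2 / (real k - d\<^sup>2) \<in> \<int> \<longleftrightarrow>
            (\<exists>n\<ge>1. is_pellian_convergent k ((moebius d (real k) ^^ n) Infty)))
       \<and> ((\<exists>n\<ge>1. is_pellian_convergent k ((moebius d (real k) ^^ n) Infty)) \<longleftrightarrow>
            infinite {n. n \<ge> 1 \<and> is_cfrac_convergent (sqrt (real k)) ((moebius d (real k) ^^ n) Infty)})"
  using integral_trace_imp_pellian[OF assms(2-4)]
    pellian_imp_infinitely_many_convergents[OF assms(2-4)]
    infinitely_many_convergents_imp_integral[OF assms(2-4)]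
  by blast

end
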